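(* Let $\mathbb{P}$ be an $\omega$-poset. If $\mathbb{P}$ is regular then the spectrum $\mathsf{S}\mathbb{P}$ is Hausdorff. The converse also holds as long as $\mathbb{P}$ is prime, i.e. if $\mathbb{P}$ is a prime $\omega$-poset and $\mathsf{S}\mathbb{P}$ is Hausdorff then $\mathbb{P}$ is regular.
   Context: Let $(\mathbb{P},\leq)$ be a poset. A subset $S\subseteq\mathbb{P}$ refines $T\subseteq\mathbb{P}$ if for every $s\in S$ there is $t\in T$ with $s\leq t$. A band of $\mathbb{P}$ is a finite subset $B\subseteq\mathbb{P}$ such that every $p\in\mathbb{P}$ is comparable to some $b\in B$. A cap of $\mathbb{P}$ is a subset refined by some band. A selector is a subset $S\subseteq\mathbb{P}$ with $S\cap C\neq\emptyset$ for every cap $C$ of $\mathbb{P}$; a minimal selector is one minimal with respect to inclusion among all selectors. The spectrum $\mathsf{S}\mathbb{P}$ is the set of all minimal selectors, with the topology generated by the subbasis consisting of the sets $p^\in=\{S\in\mathsf{S}\mathbb{P}:p\in S\}$, for $p\in\mathbb{P}$. $\mathbb{P}$ is an $\omega$-poset if every principal filter $p^\leq=\{q\in\mathbb{P}:p\leq q\}$ is finite and, for each $n\in\omega$, the number of principal filters of size $n$ is finite. A poset $\mathbb{P}$ is prime if every element of $\mathbb{P}$ lies in some minimal selector. For $p,q\in\mathbb{P}$ write $p\wedge q$ if there is $r\in\mathbb{P}$ with $r\leq p$ and $r\leq q$. For $p\in\mathbb{P}$ and a cap $C$, the star of $p$ in $C$ is $Cp=\{c\in C:c\wedge p\}$.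 The star-below relation is: $p\vartriangleleft q$ if there is a cap $C$ of $\mathbb{P}$ such that $c\leq q$ for all $c\in Cp$. The poset $\mathbb{P}$ is regular if for every cap $D$ of $\mathbb{P}$ there is a cap $C$ of $\mathbb{P}$ such that for each $c\in C$ there is $d\in D$ with $c\vartriangleleft d$. *)

theory Defs
  imports "HOL-Analysis.Analysis"
begin

text \<open>A poset is a carrier set \<open>P\<close> with a relation \<open>r\<close> satisfying \<open>partial_order_on P r\<close>, where
  \<open>(p, q) \<in> r\<close> means \<open>p \<le> q\<close>; in particular \<open>r \<subseteq> P \<times> P\<close>, and the empty poset is included.\<close>

definition refines :: "'a rel \<Rightarrow> 'a set \<Rightarrow> 'a set \<Rightarrow> bool" where
  "refines r S T \<longleftrightarrow> (\<forall>s\<in>S. \<exists>t\<in>T. (s, t) \<in> r)"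

definition is_band :: "'a set \<Rightarrow> 'a rel \<Rightarrow> 'a set \<Rightarrow> bool" where
  "is_band P r B \<longleftrightarrow>
     B \<subseteq> P \<and> finite B \<and> (\<forall>p\<in>P. \<exists>b\<in>B. (p, b) \<in> r \<or> (b, p) \<in> r)"

definition is_cap :: "'a set \<Rightarrow> 'a rel \<Rightarrow> 'a set \<Rightarrow> bool" where
  "is_cap P r C \<longleftrightarrow> C \<subseteq> P \<and> (\<exists>B. is_band P r B \<and> refines r B C)"

definition is_selector :: "'a set \<Rightarrow> 'a rel \<Rightarrow> 'a set \<Rightarrow> bool" where
  "is_selector P r S \<longleftrightarrow> S \<subseteq> P \<and> (\<forall>C. is_cap P r C \<longrightarrow> S \<inter> C \<noteq> {})"

definition is_minimal_selector :: "'a set \<Rightarrow> 'a rel \<Rightarrow> 'a set \<Rightarrow> bool" where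
  "is_minimal_selector P r S \<longleftrightarrow>
     is_selector P r S \<and> (\<forall>T. is_selector P r T \<and> T \<subseteq> S \<longrightarrow> T = S)"

definition minimal_selectors :: "'a set \<Rightarrow> 'a rel \<Rightarrow> 'a set set" where
  "minimal_selectors P r = {S. is_minimal_selector P r S}"

definition subbasic :: "'a set \<Rightarrow> 'a rel \<Rightarrow> 'a \<Rightarrow> 'a set set" where
  "subbasic P r p = {S \<in> minimal_selectors P r. p \<in> S}"

text \<open>In the library's \<open>topology_generated_by\<close> the underlying set is the union of the generators.
  The whole set of minimal selectors (the empty intersection of subbasic sets) is therefore added
  explicitly, so that it is always the underlying set, even if it has the empty set as an element.\<close>

definition spectrum :: "'a set \<Rightarrow> 'a rel \<Rightarrow> 'a set topology" where
  "spectrum P r = topology_generated_by (insert (minimal_selectors P r) (subbasic P r ` P))"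

text \<open>The principal filter of \<open>p\<close> is the library's \<open>above r p = {q. (p, q) \<in> r}\<close>.\<close>

definition omega_poset :: "'a set \<Rightarrow> 'a rel \<Rightarrow> bool" where
  "omega_poset P r \<longleftrightarrow>
     partial_order_on P r \<and>
     (\<forall>p\<in>P. finite (above r p)) \<and>
     (\<forall>n::nat. finite {F \<in> above r ` P. card F = n})"

definition prime_poset :: "'a set \<Rightarrow> 'a rel \<Rightarrow> bool" where
  "prime_poset P r \<longleftrightarrow> (\<forall>p\<in>P. \<exists>S. is_minimal_selector P r S \<and> p \<in> S)"

definition compatible :: "'a set \<Rightarrow> 'a rel \<Rightarrow> 'a \<Rightarrow> 'a \<Rightarrow> bool" where
  "compatible P r p q \<longleftrightarrow> (\<exists>s\<in>P. (s, p) \<in> r \<and> (s, q) \<in> r)"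

definition star :: "'a set \<Rightarrow> 'a rel \<Rightarrow> 'a set \<Rightarrow> 'a \<Rightarrow> 'a set" where
  "star P r C p = {c \<in> C. compatible P r c p}"

definition star_below :: "'a set \<Rightarrow> 'a rel \<Rightarrow> 'a \<Rightarrow> 'a \<Rightarrow> bool" where
  "star_below P r p q \<longleftrightarrow> (\<exists>C. is_cap P r C \<and> (\<forall>c\<in>star P r C p. (c, q) \<in> r))"

definition regular_poset :: "'a set \<Rightarrow> 'a rel \<Rightarrow> bool" where
  "regular_poset P r \<longleftrightarrow>
     (\<forall>D. is_cap P r D \<longrightarrow>
       (\<exists>C. is_cap P r C \<and> (\<forall>c\<in>C. \<exists>d\<in>D. star_below P r c d)))"

lemma topspace_spectrum [simp]: "topspace (spectrum P r) = minimal_selectors P r"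
  unfolding spectrum_def topology_generated_by_topspace by (auto simp: subbasic_def)

end

theory Submission
  imports Defs
begin

text \<open>
  Two facts about minimal selectors carry the proof. They play the roles of a neighbourhood base
  and of compactness.

  \<^item> In an \<open>\<omega>\<close>-poset any two caps have a common refinement
    (\<open>caps_common_refinement\<close>), because sufficiently deep levels of the poset refine any given
    band. Moreover, an element \<open>p\<close> of a minimal selector \<open>S\<close> is the only element of \<open>S\<close> in some
    cap, since otherwise \<open>S - {p}\<close> would still be a selector. Refining two such caps
    simultaneously shows that minimal selectors are filters (\<open>minimal_selector_directed\<close>). Hence
    the sets \<open>subbasic P r p\<close> form a base of the spectrum, and not just a subbase.
  \<^item> A set of elements that meets every minimal selector is a cap, and so has a finite subset that
    is still a cap (\<open>cap_if_meets_minimal_selectors\<close>, \<open>cap_finite_subcap\<close>). This is Zorn's lemma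
    for the sets that do not contain a cap, whose complements are the selectors.

  Suppose \<open>P\<close> is regular and \<open>s \<in> S - T\<close>. Choose a cap \<open>C\<close> whose only element in \<open>S\<close> is \<open>s\<close>.
  By regularity some \<open>d \<in> S\<close> is star-below an element of \<open>C\<close>. This element is again in \<open>S\<close>
  (\<open>minimal_selector_star_below_closed\<close>), so it is \<open>s\<close>; let the cap \<open>E\<close> witness that \<open>d\<close> is
  star-below \<open>s\<close>. Now \<open>T\<close> contains some \<open>e \<in> E\<close>, which is not below \<open>s\<close> and so is incompatible
  with \<open>d\<close>. As minimal selectors are filters, the sets of minimal selectors containing \<open>d\<close> and
  \<open>e\<close> are disjoint; they separate \<open>S\<close> and \<open>T\<close>.

  Suppose conversely that the spectrum is Hausdorff and \<open>P\<close> is prime, and let \<open>d \<in> S\<close>. Every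
  minimal selector without \<open>d\<close> contains an element that is incompatible with some element of \<open>S\<close>:
  primeness turns disjointness of basic open sets into incompatibility. Together with \<open>d\<close> these
  elements form a cap. A finite subcap involves only finitely many elements of \<open>S\<close>, and a common
  lower bound of them in \<open>S\<close> is star-below \<open>d\<close>. So for any cap \<open>D\<close>, the elements that are star-below
  some element of \<open>D\<close> meet every minimal selector, and hence form a cap.
\<close>

section \<open>Caps and minimal selectors\<close>

lemma is_cap_mono:
  assumes "is_cap P r C" "C \<subseteq> D" "D \<subseteq> P"
  shows "is_cap P r D"
  using assms unfolding is_cap_def refines_def by blast

lemma cap_finite_subcap:
  assumes "is_cap P r C"
  obtains D where "D \<subseteq> C" "finite D" "is_cap P r D"
proof -
  obtain B where B: "is_band P r B" "refines r B C" and C: "C \<subseteq> P"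
    using assms unfolding is_cap_def by blast
  obtain f where f: "\<forall>b\<in>B. f b \<in> C \<and> (b, f b) \<in> r"
    using B(2) unfolding refines_def by metis
  show thesis
  proof (rule that)
    show "f ` B \<subseteq> C" using f by blast
    show "finite (f ` B)" using B(1) unfolding is_band_def by blast
    show "is_cap P r (f ` B)"
      using B(1) f C unfolding is_cap_def refines_def by blast
  qed
qed

lemma is_selector_iff_complement_no_cap:
  assumes "S \<subseteq> P"
  shows "is_selector P r S \<longleftrightarrow> \<not> is_cap P r (P - S)"
proof
  assume "is_selector P r S"
  then show "\<not> is_cap P r (P - S)"
    unfolding is_selector_def by blast
next
  assume nc: "\<not> is_cap P r (P - S)"
  have "S \<inter> C \<noteq> {}" if C: "is_cap P r C" for C
  proof
    assume "S \<inter> C = {}"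
    then have "C \<subseteq> P - S" using C unfolding is_cap_def by blast
    then show False using nc is_cap_mono[OF C] by blast
  qed
  then show "is_selector P r S" using assms unfolding is_selector_def by blast
qed

text \<open>Zorn's lemma applies to the non-caps because being a cap is witnessed by a finite subset,
  which lies in a single member of a chain. The complement of a maximal non-cap is a minimal
  selector.\<close>

lemma cap_if_meets_minimal_selectors:
  assumes "X \<subseteq> P" and meets: "\<And>S. is_minimal_selector P r S \<Longrightarrow> S \<inter> X \<noteq> {}"
  shows "is_cap P r X"
proof (rule ccontr)
  assume ncX: "\<not> is_cap P r X"
  let ?A = "{Y. X \<subseteq> Y \<and> Y \<subseteq> P \<and> \<not> is_cap P r Y}"
  have "\<Union>\<C> \<in> ?A" if ne: "\<C> \<noteq> {}" and ch: "subset.chain ?A \<C>" for \<C>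
  proof -
    have sub: "\<C> \<subseteq> ?A" using ch by (simp add: subset_chain_def)
    have "\<not> is_cap P r (\<Union>\<C>)"
    proof
      assume "is_cap P r (\<Union>\<C>)"
      then obtain D where D: "D \<subseteq> \<Union>\<C>" "finite D" "is_cap P r D"
        by (rule cap_finite_subcap)
      obtain Y where Y: "Y \<in> \<C>" "D \<subseteq> Y"
        by (rule finite_subset_Union_chain[OF D(2,1) ne ch])
      then have "is_cap P r Y" using sub is_cap_mono[OF D(3)] by blast
      then show False using Y(1) sub by blast
    qed
    then show ?thesis using ne sub by blast
  qed
  moreover have "?A \<noteq> {}" using ncX assms(1) by blast
  ultimately obtain M where M: "M \<in> ?A" and max: "\<And>Y. Y \<in> ?A \<Longrightarrow> M \<subseteq> Y \<Longrightarrow> Y = M"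
    using subset_Zorn_nonempty[of ?A] by (metis (lifting))
  have "is_minimal_selector P r (P - M)"
    unfolding is_minimal_selector_def
  proof (intro conjI allI impI)
    show "is_selector P r (P - M)"
      using M by (simp add: is_selector_iff_complement_no_cap double_diff)
  next
    fix T assume T: "is_selector P r T \<and> T \<subseteq> P - M"
    then have TP: "T \<subseteq> P" by blast
    then have "P - T \<in> ?A" "M \<subseteq> P - T"
      using T M is_selector_iff_complement_no_cap[OF TP, of r] by blast+
    then have "P - T = M" by (rule max)
    then show "T = P - M" using TP by blast
  qed
  then show False using meets[of "P - M"] M by blast
qed

lemma minimal_selector_sole_element:
  assumes S: "is_minimal_selector P r S" and p: "p \<in> S"
  obtains C where "is_cap P r C" "S \<inter> C = {p}"
proof -
  have sel: "is_selector P r S" using S unfolding is_minimal_selector_def by blast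
  have "\<not> is_selector P r (S - {p})"
    using S p unfolding is_minimal_selector_def by blast
  then obtain C where C: "is_cap P r C" "(S - {p}) \<inter> C = {}"
    using sel unfolding is_selector_def by blast
  moreover have "S \<inter> C \<noteq> {}" using sel C(1) unfolding is_selector_def by blast
  ultimately have "S \<inter> C = {p}" by blast
  with C(1) show thesis by (rule that)
qed

locale omega_poset_space =
  fixes P :: "'a set" and r :: "'a rel"
  assumes omega: "omega_poset P r"
begin

lemma po: "partial_order_on P r"
  using omega unfolding omega_poset_def by blast

lemma rel_closed: "(p, q) \<in> r \<Longrightarrow> p \<in> P \<and> q \<in> P"
  using po unfolding partial_order_on_def preorder_on_def refl_on_def by blast

lemma rel_refl: "p \<in> P \<Longrightarrow> (p, p) \<in> r"
  using po unfolding partial_order_on_def preorder_on_def refl_on_def by blast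

lemma rel_trans: "(p, q) \<in> r \<Longrightarrow> (q, s) \<in> r \<Longrightarrow> (p, s) \<in> r"
  using po unfolding partial_order_on_def preorder_on_def by (meson transD)

lemma rel_antisym: "(p, q) \<in> r \<Longrightarrow> (q, p) \<in> r \<Longrightarrow> p = q"
  using po unfolding partial_order_on_def by (meson antisymD)

lemma finite_above: "p \<in> P \<Longrightarrow> finite (above r p)"
  using omega unfolding omega_poset_def by blast

lemma mem_above [simp]: "q \<in> above r p \<longleftrightarrow> (p, q) \<in> r"
  by (simp add: above_def)

lemma finite_bounded_filters: "finite {p \<in> P. card (above r p) \<le> n}"
proof -
  let ?Q = "{p \<in> P. card (above r p) \<le> n}"
  have "above r ` ?Q \<subseteq> (\<Union>k\<in>{..n}. {F \<in> above r ` P. card F = k})" by blast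
  moreover have "finite (\<Union>k\<in>{..n}. {F \<in> above r ` P. card F = k})"
    using omega unfolding omega_poset_def by blast
  ultimately have "finite (above r ` ?Q)" by (rule finite_subset)
  moreover have "inj_on (above r) ?Q"
    by (rule inj_onI) (metis (lifting) mem_Collect_eq mem_above rel_antisym rel_refl)
  ultimately show ?thesis by (rule finite_imageD)
qed

text \<open>If \<open>S\<close> meets a cap only in \<open>p\<close>, then replacing \<open>p\<close> by \<open>q\<close> in this cap yields a coarser cap,
  which \<open>S\<close> can only meet in \<open>q\<close>.\<close>

lemma minimal_selector_up_closed:
  assumes S: "is_minimal_selector P r S" and p: "p \<in> S" and pq: "(p, q) \<in> r"
  shows "q \<in> S"
proof -
  obtain C where C: "is_cap P r C" "S \<inter> C = {p}"
    using minimal_selector_sole_element[OF S p] .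
  obtain B where B: "C \<subseteq> P" "is_band P r B" "refines r B C"
    using C(1) unfolding is_cap_def by blast
  have "refines r B (insert q (C - {p}))"
    unfolding refines_def
  proof
    fix b assume "b \<in> B"
    then obtain c where "c \<in> C" "(b, c) \<in> r" using B(3) unfolding refines_def by blast
    then show "\<exists>t\<in>insert q (C - {p}). (b, t) \<in> r"
      using rel_trans pq by (cases "c = p") blast+
  qed
  then have "is_cap P r (insert q (C - {p}))"
    using B rel_closed[OF pq] unfolding is_cap_def by blast
  then have "S \<inter> insert q (C - {p}) \<noteq> {}"
    using S unfolding is_minimal_selector_def is_selector_def by blast
  then show ?thesis using C(2) by blast
qed

section \<open>Levels and common refinements of caps\<close>

text \<open>The elements all of whose strictly increasing chains upwards have at most \<open>n\<close> elements.\<close>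

primrec rank_cone :: "nat \<Rightarrow> 'a set" where
  "rank_cone 0 = {}"
| "rank_cone (Suc n) = {p \<in> P. \<forall>q. (p, q) \<in> r \<and> q \<noteq> p \<longrightarrow> q \<in> rank_cone n}"

definition level :: "nat \<Rightarrow> 'a set" where
  "level n = {p \<in> rank_cone n. \<forall>q \<in> rank_cone n. (q, p) \<in> r \<longrightarrow> q = p}"

lemma rank_cone_subset: "rank_cone n \<subseteq> P"
  by (cases n) auto

lemma rank_cone_Suc: "rank_cone n \<subseteq> rank_cone (Suc n)"
proof (induction n)
  case (Suc n)
  show ?case
  proof
    fix p assume "p \<in> rank_cone (Suc n)"
    then show "p \<in> rank_cone (Suc (Suc n))" using Suc by force
  qed
qed simp

lemma rank_cone_mono: "m \<le> n \<Longrightarrow> rank_cone m \<subseteq> rank_cone n"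
  by (rule lift_Suc_mono_le[of rank_cone]) (rule rank_cone_Suc)

text \<open>An element of \<open>rank_cone (Suc n)\<close> has its principal filter inside \<open>rank_cone n\<close>, apart from
  the element itself. Hence these filters have bounded size, and there are only finitely many.\<close>

lemma finite_rank_cone: "finite (rank_cone n)"
proof (induction n)
  case (Suc n)
  have "card (above r p) \<le> Suc (card (rank_cone n))" if "p \<in> rank_cone (Suc n)" for p
  proof -
    have "above r p \<subseteq> insert p (rank_cone n)" using that by auto
    then have "card (above r p) \<le> card (insert p (rank_cone n))"
      using Suc by (intro card_mono) auto
    also have "\<dots> \<le> Suc (card (rank_cone n))" by (rule card_insert_le_m1) auto
    finally show ?thesis .
  qed
  then have "rank_cone (Suc n) \<subseteq> {p \<in> P. card (above r p) \<le> Suc (card (rank_cone n))}"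
    using rank_cone_subset by blast
  then show ?case using finite_bounded_filters finite_subset by blast
qed simp

lemma finite_subset_rank_cone:
  assumes "finite A" "\<And>a. a \<in> A \<Longrightarrow> \<exists>n. a \<in> rank_cone n"
  shows "\<exists>n. A \<subseteq> rank_cone n"
  using assms
proof (induction A rule: finite_induct)
  case (insert a A)
  then obtain m n where "A \<subseteq> rank_cone m" "a \<in> rank_cone n" by blast
  then have "insert a A \<subseteq> rank_cone (max m n)"
    using rank_cone_mono[of m "max m n"] rank_cone_mono[of n "max m n"] by auto
  then show ?case by blast
qed simp

lemma rank_cone_exhausts:
  assumes "p \<in> P"
  shows "\<exists>n. p \<in> rank_cone n"
  using assms
proof (induction "card (above r p)" arbitrary: p rule: less_induct)
  case less
  have "\<exists>n. q \<in> rank_cone n" if q: "q \<in> above r p - {p}" for q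
  proof -
    have "p \<notin> above r q" using q rel_antisym by auto
    moreover have "above r q \<subseteq> above r p" using q rel_trans by auto
    ultimately have "above r q \<subset> above r p" using less.prems rel_refl by auto
    then have "card (above r q) < card (above r p)"
      using finite_above[OF less.prems] by (rule psubset_card_mono[rotated])
    then show ?thesis using less.hyps q rel_closed by auto
  qed
  then obtain n where "above r p - {p} \<subseteq> rank_cone n"
    using finite_subset_rank_cone[of "above r p - {p}"] finite_above[OF less.prems] by auto
  then have "p \<in> rank_cone (Suc n)" using less.prems by auto
  then show ?case by blast
qed

lemma exists_minimal_below:
  assumes "finite A" "A \<subseteq> P" "a \<in> A"
  obtains m where "m \<in> A" "(m, a) \<in> r" "\<And>q. q \<in> A \<Longrightarrow> (q, m) \<in> r \<Longrightarrow> q = m"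
proof -
  let ?R = "\<lambda>x y. (x, y) \<in> r \<and> x \<noteq> y"
  have "asymp_on {x \<in> A. (x, a) \<in> r} ?R"
    using rel_antisym by (auto intro: asymp_onI)
  moreover have "transp_on {x \<in> A. (x, a) \<in> r} ?R"
    using rel_antisym rel_trans by (intro transp_onI) blast
  moreover have "{x \<in> A. (x, a) \<in> r} \<noteq> {}" using assms rel_refl by blast
  ultimately obtain m where "m \<in> {x \<in> A. (x, a) \<in> r}"
    "\<forall>x\<in>{x \<in> A. (x, a) \<in> r}. x \<noteq> m \<longrightarrow> \<not> ?R x m"
    using Finite_Set.bex_min_element[of "{x \<in> A. (x, a) \<in> r}" ?R] assms(1) by auto
  then show thesis using that rel_trans by blast
qed

lemma exists_maximal_above:
  assumes "p \<in> P" "p \<notin> X"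
  obtains q where "(p, q) \<in> r" "q \<notin> X" "\<And>s. (q, s) \<in> r \<Longrightarrow> s \<noteq> q \<Longrightarrow> s \<in> X"
proof -
  let ?R = "\<lambda>x y. (x, y) \<in> r \<and> x \<noteq> y"
  have "asymp_on (above r p - X) ?R"
    using rel_antisym by (auto intro: asymp_onI)
  moreover have "transp_on (above r p - X) ?R"
    using rel_antisym rel_trans by (intro transp_onI) blast
  moreover have "above r p - X \<noteq> {}" using assms rel_refl[OF assms(1)] mem_above by blast
  ultimately obtain q where q: "q \<in> above r p - X"
    "\<forall>x\<in>above r p - X. x \<noteq> q \<longrightarrow> \<not> ?R q x"
    using Finite_Set.bex_max_element[OF finite_Diff[OF finite_above[OF assms(1)]], of X ?R]
    by blast
  show thesis
  proof (rule that)
    show "(p, q) \<in> r" "q \<notin> X" using q(1) by simp_all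
    show "s \<in> X" if "(q, s) \<in> r" "s \<noteq> q" for s
      using that q rel_trans[of p q s] by auto
  qed
qed

text \<open>Levels start at the cone \<open>Suc n\<close> because the cone \<open>0\<close> is empty. An element outside this
  cone lies below some \<open>q\<close> maximal outside the cone \<open>n\<close>, and such a \<open>q\<close> is minimal in the cone
  \<open>Suc n\<close>: anything strictly below \<open>q\<close> has an element outside the cone \<open>n\<close> strictly above it.\<close>

lemma level_Suc_is_band: "is_band P r (level (Suc n))"
  unfolding is_band_def
proof (intro conjI ballI)
  show "level (Suc n) \<subseteq> P" using rank_cone_subset unfolding level_def by blast
  show "finite (level (Suc n))" using finite_rank_cone[of "Suc n"] unfolding level_def by (rule rev_finite_subset) blast
  fix p assume p: "p \<in> P"
  show "\<exists>b\<in>level (Suc n). (p, b) \<in> r \<or> (b, p) \<in> r"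
  proof (cases "p \<in> rank_cone (Suc n)")
    case True
    obtain m where "m \<in> rank_cone (Suc n)" "(m, p) \<in> r"
      "\<And>q. q \<in> rank_cone (Suc n) \<Longrightarrow> (q, m) \<in> r \<Longrightarrow> q = m"
      by (rule exists_minimal_below[OF finite_rank_cone rank_cone_subset True]) blast
    then show ?thesis unfolding level_def by blast
  next
    case False
    then have "p \<notin> rank_cone n" using rank_cone_Suc by blast
    then obtain q where q: "(p, q) \<in> r" "q \<notin> rank_cone n"
      "\<And>s. (q, s) \<in> r \<Longrightarrow> s \<noteq> q \<Longrightarrow> s \<in> rank_cone n"
      using exists_maximal_above[OF p] by blast
    have "q \<in> rank_cone (Suc n)" using q rel_closed by auto
    moreover have "s = q" if "s \<in> rank_cone (Suc n)" "(s, q) \<in> r" for s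
      using that q(2) by auto
    ultimately have "q \<in> level (Suc n)" unfolding level_def by blast
    then show ?thesis using q(1) by blast
  qed
qed

text \<open>No element of the cone lies strictly below an element of the level, so an element of the level
  that is comparable to an element of the band lies below it.\<close>

lemma level_refines_band:
  assumes "is_band P r B" "B \<subseteq> rank_cone n"
  shows "refines r (level n) B"
  unfolding refines_def
proof
  fix p assume p: "p \<in> level n"
  then have "p \<in> P" using rank_cone_subset unfolding level_def by blast
  then obtain b where "b \<in> B" "(p, b) \<in> r \<or> (b, p) \<in> r"
    using assms(1) unfolding is_band_def by blast
  then show "\<exists>b\<in>B. (p, b) \<in> r" using p assms(2) unfolding level_def by blast
qed

lemma refines_trans: "refines r A B \<Longrightarrow> refines r B C \<Longrightarrow> refines r A C"
  unfolding refines_def using rel_trans by meson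

lemma band_is_cap: "is_band P r B \<Longrightarrow> is_cap P r B"
  unfolding is_cap_def refines_def is_band_def using rel_refl by blast

lemma caps_common_refinement:
  assumes "is_cap P r C" "is_cap P r D"
  obtains G where "is_cap P r G" "refines r G C" "refines r G D"
proof -
  obtain A B where A: "is_band P r A" "refines r A C" and B: "is_band P r B" "refines r B D"
    using assms unfolding is_cap_def by blast
  then have "finite (A \<union> B)" "A \<union> B \<subseteq> P" unfolding is_band_def by blast+
  then obtain n where n: "A \<union> B \<subseteq> rank_cone n"
    using finite_subset_rank_cone[of "A \<union> B"] rank_cone_exhausts by blast
  then have n': "A \<union> B \<subseteq> rank_cone (Suc n)" using rank_cone_Suc by blast
  show thesis
  proof (rule that)
    show "is_cap P r (level (Suc n))" by (rule band_is_cap[OF level_Suc_is_band])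
    show "refines r (level (Suc n)) C"
      using refines_trans[OF level_refines_band A(2)] A(1) n' by blast
    show "refines r (level (Suc n)) D"
      using refines_trans[OF level_refines_band B(2)] B(1) n' by blast
  qed
qed

section \<open>Minimal selectors as filters and the topology of the spectrum\<close>

lemma minimal_selector_meets_cap:
  "is_minimal_selector P r S \<Longrightarrow> is_cap P r C \<Longrightarrow> \<exists>c\<in>C. c \<in> S"
  unfolding is_minimal_selector_def is_selector_def by blast

lemma minimal_selector_subset: "is_minimal_selector P r S \<Longrightarrow> S \<subseteq> P"
  unfolding is_minimal_selector_def is_selector_def by blast

text \<open>Refine two caps that meet \<open>S\<close> only in \<open>p\<close> and only in \<open>q\<close>, respectively. An element of \<open>S\<close> in
  the refinement lies below an element of each of them; these elements are again in \<open>S\<close>, so they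
  must be \<open>p\<close> and \<open>q\<close>.\<close>

lemma minimal_selector_directed:
  assumes S: "is_minimal_selector P r S" and p: "p \<in> S" and q: "q \<in> S"
  obtains s where "s \<in> S" "(s, p) \<in> r" "(s, q) \<in> r"
proof -
  obtain C where C: "is_cap P r C" "S \<inter> C = {p}"
    using minimal_selector_sole_element[OF S p] .
  obtain D where D: "is_cap P r D" "S \<inter> D = {q}"
    using minimal_selector_sole_element[OF S q] .
  obtain G where G: "is_cap P r G" "refines r G C" "refines r G D"
    using caps_common_refinement[OF C(1) D(1)] .
  obtain s where s: "s \<in> G" "s \<in> S" using minimal_selector_meets_cap[OF S G(1)] by blast
  obtain c d where cd: "c \<in> C" "(s, c) \<in> r" "d \<in> D" "(s, d) \<in> r"
    using G s(1) unfolding refines_def by meson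
  then have "c \<in> S" "d \<in> S"
    using minimal_selector_up_closed[OF S s(2)] by blast+
  then have "c = p" "d = q" using cd C(2) D(2) by blast+
  then have "(s, p) \<in> r" "(s, q) \<in> r" using cd by simp_all
  with s(2) show thesis by (rule that)
qed

lemma minimal_selector_compatible:
  assumes "is_minimal_selector P r S" "p \<in> S" "q \<in> S"
  shows "compatible P r p q"
  using minimal_selector_directed[OF assms] rel_closed unfolding compatible_def by meson

lemma minimal_selector_nonempty:
  assumes "is_minimal_selector P r S"
  shows "\<exists>p. p \<in> S"
  using minimal_selector_meets_cap[OF assms band_is_cap[OF level_Suc_is_band]] by blast

lemma minimal_selector_finite_lower_bound:
  assumes S: "is_minimal_selector P r S" and "finite A" "A \<subseteq> S"
  shows "\<exists>s\<in>S. \<forall>a\<in>A. (s, a) \<in> r"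
  using assms(2,3)
proof (induction A rule: finite_induct)
  case empty
  then show ?case using minimal_selector_nonempty[OF S] by blast
next
  case (insert a A)
  then obtain t where t: "t \<in> S" "\<forall>a\<in>A. (t, a) \<in> r" by auto
  obtain s where "s \<in> S" "(s, t) \<in> r" "(s, a) \<in> r"
    using minimal_selector_directed[OF S t(1), of a] insert.prems by blast
  then show ?case using t(2) rel_trans by blast
qed

lemma openin_subbasic: "p \<in> P \<Longrightarrow> openin (spectrum P r) (subbasic P r p)"
  unfolding spectrum_def by (rule topology_generated_by_Basis) simp

text \<open>If \<open>S\<close> lies in two subbasic sets, then a common lower bound in \<open>S\<close> of the two elements
  gives a subbasic set inside their intersection.\<close>

lemma subbasic_is_base:
  assumes "openin (spectrum P r) U" "S \<in> U"
  shows "\<exists>p\<in>S. subbasic P r p \<subseteq> U"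
proof -
  have "generate_topology_on (insert (minimal_selectors P r) (subbasic P r ` P)) U"
    using assms(1) unfolding spectrum_def openin_topology_generated_by_iff .
  moreover have S: "is_minimal_selector P r S"
    using openin_subset[OF assms(1)] assms(2) by (auto simp: minimal_selectors_def)
  ultimately show ?thesis using assms(2)
  proof induction
    case (Int U V)
    then obtain p q where pq: "p \<in> S" "q \<in> S" "subbasic P r p \<subseteq> U" "subbasic P r q \<subseteq> V"
      by blast
    obtain s where s: "s \<in> S" "(s, p) \<in> r" "(s, q) \<in> r"
      using minimal_selector_directed[OF S pq(1,2)] .
    have "subbasic P r s \<subseteq> subbasic P r p \<inter> subbasic P r q"
      using s(2,3) minimal_selector_up_closed
      unfolding subbasic_def minimal_selectors_def by blast
    then show ?case using s(1) pq(3,4) by blast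
  next
    case (Basis U)
    then show ?case
      using minimal_selector_nonempty[OF S] unfolding subbasic_def by blast
  qed blast+
qed

section \<open>Regularity and the Hausdorff property\<close>

text \<open>If \<open>S\<close> contains \<open>p\<close>, then all elements of \<open>S\<close> in the witnessing cap are in the star of \<open>p\<close>.\<close>

lemma minimal_selector_star_below_closed:
  assumes S: "is_minimal_selector P r S" and "p \<in> S" "star_below P r p q"
  shows "q \<in> S"
proof -
  obtain E where E: "is_cap P r E" "\<forall>e\<in>star P r E p. (e, q) \<in> r"
    using assms(3) unfolding star_below_def by blast
  obtain e where e: "e \<in> E" "e \<in> S" using minimal_selector_meets_cap[OF S E(1)] by blast
  then have "(e, q) \<in> r"
    using E(2) minimal_selector_compatible[OF S e(2) assms(2)] unfolding star_def by blast
  then show ?thesis using minimal_selector_up_closed[OF S e(2)] by blast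
qed

lemma regular_imp_Hausdorff:
  assumes reg: "regular_poset P r"
  shows "Hausdorff_space (spectrum P r)"
  unfolding Hausdorff_space_def
proof (intro allI impI, elim conjE)
  fix S T
  assume "S \<in> topspace (spectrum P r)" "T \<in> topspace (spectrum P r)" and ne: "S \<noteq> T"
  then have S: "is_minimal_selector P r S" and T: "is_minimal_selector P r T"
    by (simp_all add: minimal_selectors_def)
  then have "\<not> S \<subseteq> T" using ne unfolding is_minimal_selector_def by blast
  then obtain s where s: "s \<in> S" "s \<notin> T" by blast
  obtain C where C: "is_cap P r C" "S \<inter> C = {s}"
    using minimal_selector_sole_element[OF S s(1)] .
  obtain D where D: "is_cap P r D" "\<forall>d\<in>D. \<exists>c\<in>C. star_below P r d c"
    using reg C(1) unfolding regular_poset_def by blast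
  obtain d where d: "d \<in> D" "d \<in> S" using minimal_selector_meets_cap[OF S D(1)] by blast
  then obtain c where c: "c \<in> C" "star_below P r d c" using D(2) by blast
  then have "c \<in> S" using minimal_selector_star_below_closed[OF S d(2)] by blast
  then have "c = s" using c(1) C(2) by blast
  with c(2) have "star_below P r d s" by simp
  then obtain E where E: "is_cap P r E" "\<forall>e\<in>star P r E d. (e, s) \<in> r"
    unfolding star_below_def by blast
  obtain e where e: "e \<in> E" "e \<in> T" using minimal_selector_meets_cap[OF T E(1)] by blast
  then have "\<not> compatible P r e d"
    using E(2) s(2) minimal_selector_up_closed[OF T e(2)] unfolding star_def by blast
  then have "disjnt (subbasic P r d) (subbasic P r e)"
    using minimal_selector_compatible
    unfolding disjnt_def subbasic_def minimal_selectors_def by blast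
  moreover have "S \<in> subbasic P r d" "T \<in> subbasic P r e"
    using S T d e by (simp_all add: subbasic_def minimal_selectors_def)
  moreover have "d \<in> P" "e \<in> P" using S T d e minimal_selector_subset by blast+
  ultimately show "\<exists>U V. openin (spectrum P r) U \<and> openin (spectrum P r) V \<and>
      S \<in> U \<and> T \<in> V \<and> disjnt U V"
    using openin_subbasic by meson
qed

text \<open>A common lower bound of two elements lies in some minimal selector when \<open>P\<close> is prime, so
  disjoint subbasic sets come from incompatible elements.\<close>

lemma Hausdorff_separates_by_incompatible:
  assumes prime: "prime_poset P r" and H: "Hausdorff_space (spectrum P r)"
    and S: "is_minimal_selector P r S" and T: "is_minimal_selector P r T" and ne: "S \<noteq> T"
  shows "\<exists>s\<in>S. \<exists>t\<in>T. \<not> compatible P r s t"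
proof -
  have "S \<in> topspace (spectrum P r)" "T \<in> topspace (spectrum P r)"
    using S T by (simp_all add: minimal_selectors_def)
  then obtain U V where UV: "openin (spectrum P r) U" "openin (spectrum P r) V"
    "S \<in> U" "T \<in> V" "disjnt U V"
    using H ne unfolding Hausdorff_space_def by meson
  obtain s t where st: "s \<in> S" "t \<in> T" "subbasic P r s \<subseteq> U" "subbasic P r t \<subseteq> V"
    using subbasic_is_base[OF UV(1,3)] subbasic_is_base[OF UV(2,4)] by blast
  have "\<not> compatible P r s t"
  proof
    assume "compatible P r s t"
    then obtain q where q: "q \<in> P" "(q, s) \<in> r" "(q, t) \<in> r"
      unfolding compatible_def by blast
    then obtain R where R: "is_minimal_selector P r R" "q \<in> R"
      using prime unfolding prime_poset_def by blast
    then have "R \<in> subbasic P r s \<inter> subbasic P r t"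
      using q minimal_selector_up_closed unfolding subbasic_def minimal_selectors_def by blast
    then show False using st(3,4) UV(5) unfolding disjnt_def by blast
  qed
  then show ?thesis using st(1,2) by blast
qed

lemma Hausdorff_imp_star_below:
  assumes prime: "prime_poset P r" and H: "Hausdorff_space (spectrum P r)"
    and S: "is_minimal_selector P r S" and d: "d \<in> S"
  shows "\<exists>c\<in>S. star_below P r c d"
proof -
  let ?X = "insert d {t \<in> P. \<exists>s\<in>S. \<not> compatible P r s t}"
  have "is_cap P r ?X"
  proof (rule cap_if_meets_minimal_selectors)
    show "?X \<subseteq> P" using d minimal_selector_subset[OF S] by blast
    fix T assume T: "is_minimal_selector P r T"
    show "T \<inter> ?X \<noteq> {}"
    proof (cases "T = S")
      case True
      then show ?thesis using d by blast
    next
      case False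
      then show ?thesis
        using Hausdorff_separates_by_incompatible[OF prime H S T] minimal_selector_subset[OF T]
        by blast
    qed
  qed
  then obtain E where E: "E \<subseteq> ?X" "finite E" "is_cap P r E"
    by (rule cap_finite_subcap)
  then have "\<forall>e\<in>E - {d}. \<exists>s\<in>S. \<not> compatible P r s e" by blast
  then obtain f where f: "\<forall>e\<in>E - {d}. f e \<in> S \<and> \<not> compatible P r (f e) e" by metis
  obtain c where c: "c \<in> S" "\<forall>a\<in>f ` (E - {d}). (c, a) \<in> r"
    using minimal_selector_finite_lower_bound[OF S, of "f ` (E - {d})"] E(2) f by blast
  \<comment> \<open>Being below every \<open>f e\<close>, the element \<open>c\<close> is incompatible with all of \<open>E\<close> except possibly \<open>d\<close>.\<close>
  have "(e, d) \<in> r" if e: "e \<in> star P r E c" for e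
  proof -
    obtain q where q: "q \<in> P" "(q, e) \<in> r" "(q, c) \<in> r" and "e \<in> E"
      using e unfolding star_def compatible_def by blast
    have "e = d"
    proof (rule ccontr)
      assume "e \<noteq> d"
      then have e': "e \<in> E - {d}" using \<open>e \<in> E\<close> by blast
      then have "(q, f e) \<in> r" using c(2) q(3) rel_trans by blast
      then have "compatible P r (f e) e" using q unfolding compatible_def by blast
      then show False using f e' by blast
    qed
    then show ?thesis using d minimal_selector_subset[OF S] rel_refl by blast
  qed
  then have "star_below P r c d" using E(3) unfolding star_below_def by blast
  then show ?thesis using c(1) by blast
qed

lemma prime_Hausdorff_imp_regular:
  assumes prime: "prime_poset P r" and H: "Hausdorff_space (spectrum P r)"
  shows "regular_poset P r"
  unfolding regular_poset_def
proof (intro allI impI)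
  fix D assume D: "is_cap P r D"
  let ?C = "{c \<in> P. \<exists>d\<in>D. star_below P r c d}"
  have "is_cap P r ?C"
  proof (rule cap_if_meets_minimal_selectors)
    fix S assume S: "is_minimal_selector P r S"
    then obtain d where "d \<in> D" "d \<in> S" using minimal_selector_meets_cap[OF _ D] by blast
    then show "S \<inter> ?C \<noteq> {}"
      using Hausdorff_imp_star_below[OF prime H S] minimal_selector_subset[OF S] by blast
  qed blast
  then show "\<exists>C. is_cap P r C \<and> (\<forall>c\<in>C. \<exists>d\<in>D. star_below P r c d)" by blast
qed

end

theorem corollary2p40:
  fixes P :: "'a set" and r :: "'a rel"
  assumes "omega_poset P r"
  shows "(regular_poset P r \<longrightarrow> Hausdorff_space (spectrum P r)) \<and>
    (prime_poset P r \<and> Hausdorff_space (spectrum P r) \<longrightarrow> regular_poset P r)"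
proof -
  interpret omega_poset_space P r by (rule omega_poset_space.intro[OF assms])
  show ?thesis using regular_imp_Hausdorff prime_Hausdorff_imp_regular by blast
qed

end
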